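(* Let $n\ge1$ and let $F:\mathbb{R}^n\to\mathbb{R}^{n+1}\to\mathbb{R}$ be a ReLU neural network with input dimension $n$ and a single hidden layer of dimension $n+1$. Let $t\in\mathbb{R}$ be a transversal threshold for $F$. Then each of the decision regions $Y_F(t)=F^{-1}((t,\infty))$ and $N_F(t)=F^{-1}((-\infty,t))$ has at most one bounded connected component.
   Context: Here $F=A_2\circ\sigma\circ A_1$ with $A_1:\mathbb{R}^n\to\mathbb{R}^{n+1}$ and $A_2:\mathbb{R}^{n+1}\to\mathbb{R}$ arbitrary affine maps, and $\sigma$ applying $\mathrm{ReLU}(x)=\max\{0,x\}$ to each coordinate. Write $A_1(x)=Wx+b$. The hyperplane arrangement $\mathcal{A}$ in $\mathbb{R}^n$ associated to the hidden layer consists of the hyperplanes $\{x:W_j\cdot x+b_j=0\}$ for those rows $j$ with $W_j\ne0$. The canonical polyhedral complex $\mathcal{C}(F)$ is the polyhedral decomposition $\mathcal{C}(\mathcal{A})$ of $\mathbb{R}^n$ whose $n$-cells are the closures of the connected components of $\mathbb{R}^n\setminus\bigcup_{H\in\mathcal{A}}H$ and whose lower-dimensional cells are the faces of these; $F$ is affine-linear on each cell. A number $t\in\mathbb{R}$ is a transversal threshold for $F$ if for every cell $C$ of $\mathcal{C}(F)$ of dimension $\ge1$ the restriction of $F$ to the relative interior $\mathrm{int}(C)$ is transverse to $\{t\}$ (its differential is surjective at every point of $\mathrm{int}(C)\cap F^{-1}(t)$), and $F(v)\ne t$ for every $0$-cell $v$ of $\mathcal{C}(F)$. *)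

theory Defs
  imports "HOL-Analysis.Analysis"
begin

definition relu :: "real \<Rightarrow> real" where
  "relu x = max 0 x"

definition relu_layer :: "real ^ 'm \<Rightarrow> real ^ 'm" where
  "relu_layer y = (\<chi> j. relu (y $ j))"

text \<open>The two affine maps are given by their weights and biases:
  \<open>x \<mapsto> W x + b\<close> into the hidden layer and \<open>y \<mapsto> w \<bullet> y + c\<close> out of it.\<close>

definition relu_network ::
    "real ^ 'n ^ 'm \<Rightarrow> real ^ 'm \<Rightarrow> real ^ 'm \<Rightarrow> real \<Rightarrow> real ^ 'n \<Rightarrow> real" where
  "relu_network W b w c = (\<lambda>y. w \<bullet> y + c) \<circ> relu_layer \<circ> (\<lambda>x. W *v x + b)"

definition hidden_arrangement :: "real ^ 'n ^ 'm \<Rightarrow> real ^ 'm \<Rightarrow> (real ^ 'n) set set" where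
  "hidden_arrangement W b = {{x. W $ j \<bullet> x + b $ j = 0} | j. W $ j \<noteq> 0}"

text \<open>The relation \<open>face_of\<close> is reflexive on convex sets, so the top-dimensional cells are
  included; it also admits the empty face, which is excluded here.\<close>

definition arrangement_complex :: "'a::euclidean_space set set \<Rightarrow> 'a set set" where
  "arrangement_complex \<A> =
     {C. C \<noteq> {} \<and> (\<exists>R \<in> components (- \<Union>\<A>). C face_of closure R)}"

definition canonical_complex :: "real ^ 'n ^ 'm \<Rightarrow> real ^ 'm \<Rightarrow> (real ^ 'n) set set" where
  "canonical_complex W b = arrangement_complex (hidden_arrangement W b)"

text \<open>The relative interior of \<open>C\<close> is open in \<open>affine hull C\<close>, so its tangent space at \<open>x\<close> is
  the direction space of that affine hull. A derivative \<open>D\<close> within the relative interior is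
  determined only on this space; its restriction there is the differential of the
  restriction of \<open>F\<close>.\<close>

definition transverse_on_cell :: "('a::euclidean_space \<Rightarrow> real) \<Rightarrow> 'a set \<Rightarrow> real \<Rightarrow> bool" where
  "transverse_on_cell F C t \<longleftrightarrow>
     (\<forall>x \<in> rel_interior C. F x = t \<longrightarrow>
        (\<exists>D. (F has_derivative D) (at x within rel_interior C) \<and>
             D ` {y - x | y. y \<in> affine hull C} = UNIV))"

definition transversal_threshold ::
    "('a::euclidean_space \<Rightarrow> real) \<Rightarrow> 'a set set \<Rightarrow> real \<Rightarrow> bool" where
  "transversal_threshold F \<C> t \<longleftrightarrow>
     (\<forall>C \<in> \<C>. aff_dim C \<ge> 1 \<longrightarrow> transverse_on_cell F C t) \<and>
     (\<forall>v. {v} \<in> \<C> \<longrightarrow> F v \<noteq> t)"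

definition region_above :: "('a \<Rightarrow> real) \<Rightarrow> real \<Rightarrow> 'a set" where
  "region_above F t = F -` {t<..}"

definition region_below :: "('a \<Rightarrow> real) \<Rightarrow> real \<Rightarrow> 'a set" where
  "region_below F t = F -` {..<t}"

end

(* The n+1 rows of W satisfy a linear relation l. If W is injective, its range is the hyperplane
   orthogonal to l, so for any two rows i, j one may move in input space so that only the
   pre-activations i and j change, in the directions l_j and -l_i. A bounded component of a strict
   superlevel set contains no point from which such a ray never lowers F. This forces all products
   w_j l_j to be nonzero of one sign, at most one output weight w_i to be positive, and the
   pre-activation i to be positive on the component. But F is concave where that pre-activation is
   positive, so all bounded components contain one and the same convex set. *)
theory Submission
  imports Defs
begin

section \<open>The network as a weighted sum of convex ReLU terms\<close>

lemma relu_network_eq_sum: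
  "relu_network W b w c x = (\<Sum>j\<in>UNIV. w $ j * relu (W $ j \<bullet> x + b $ j)) + c"
  by (simp add: relu_network_def relu_layer_def inner_vec_def[of w] matrix_vector_mul_component)

lemma relu_network_uminus: "relu_network W b (- w) (- c) x = - relu_network W b w c x"
  by (simp add: relu_network_eq_sum sum_negf)

lemma relu_mono: "x \<le> y \<Longrightarrow> relu x \<le> relu y"
  by (simp add: relu_def)

lemma relu_nonneg: "0 \<le> relu x"
  by (simp add: relu_def)

lemma convex_on_relu: "convex_on UNIV relu"
proof (rule convex_onI)
  fix s x y :: real
  assume s: "0 < s" "s < 1"
  have "(1 - s) * x \<le> (1 - s) * max 0 x" "s * y \<le> s * max 0 y"
    "0 \<le> (1 - s) * max 0 x" "0 \<le> s * max 0 y"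
    using s by (auto intro: mult_left_mono)
  then show "relu ((1 - s) *\<^sub>R x + s *\<^sub>R y) \<le> (1 - s) * relu x + s * relu y"
    unfolding relu_def by simp
qed simp

lemma convex_on_relu_affine:
  fixes a :: "'a::real_inner"
  assumes "convex S"
  shows "convex_on S (\<lambda>x. relu (a \<bullet> x + b))"
proof (rule convex_onI)
  fix s :: real and x y :: 'a
  assume s: "0 < s" "s < 1"
  have "a \<bullet> ((1 - s) *\<^sub>R x + s *\<^sub>R y) + b = (1 - s) *\<^sub>R (a \<bullet> x + b) + s *\<^sub>R (a \<bullet> y + b)"
    by (simp add: inner_add_right algebra_simps)
  then show "relu (a \<bullet> ((1 - s) *\<^sub>R x + s *\<^sub>R y) + b)
      \<le> (1 - s) * relu (a \<bullet> x + b) + s * relu (a \<bullet> y + b)"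
    using convex_onD[OF convex_on_relu, of s "a \<bullet> x + b" "a \<bullet> y + b"] s by simp
qed (fact assms)

lemma convex_on_sum_UNIV:
  assumes "\<And>j::'m::finite. convex_on S (f j)" "convex S"
  shows "convex_on S (\<lambda>x. \<Sum>j\<in>UNIV. f j x)"
proof -
  have "finite I \<Longrightarrow> convex_on S (\<lambda>x. \<Sum>j\<in>I. f j x)" for I
    by (induction I rule: finite_induct) (auto intro: convex_on_add assms convex_on_const[THEN iffD2])
  then show ?thesis by simp
qed

section \<open>Bounded components of superlevel sets of a real function\<close>

text \<open>The ray is connected and stays in the superlevel set, so the component of its starting
  point contains all of it.\<close>

lemma unbounded_component_if_nondecreasing_ray:
  fixes F :: "'a::euclidean_space \<Rightarrow> real"
  assumes K: "K \<in> components (region_above F t)" and x: "x \<in> K" and h: "h \<noteq> 0"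
    and ray: "\<And>s. s \<ge> 0 \<Longrightarrow> F x \<le> F (x + s *\<^sub>R h)"
  shows "\<not> bounded K"
proof
  assume "bounded K"
  then obtain B where B: "\<And>y. y \<in> K \<Longrightarrow> norm y \<le> B"
    by (auto simp: bounded_iff)
  let ?R = "(\<lambda>s. x + s *\<^sub>R h) ` {0..}"
  have "connected ?R"
    by (intro connected_continuous_image continuous_intros) simp
  moreover have "t < F x"
    using K x in_components_subset by (fastforce simp: region_above_def)
  then have "?R \<subseteq> region_above F t"
    using ray by (force simp: region_above_def)
  moreover have "x \<in> ?R"
    by (auto intro!: image_eqI[of _ _ 0])
  ultimately have R: "?R \<subseteq> K"
    using components_maximal[OF K] x by blast
  \<comment> \<open>Far enough out that the triangle inequality pushes
    \<open>x + s *\<^sub>R h\<close> beyond the bound \<open>B\<close>.\<close>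
  define s where "s = (norm x + \<bar>B\<bar> + 1) / norm h"
  have s: "s \<ge> 0" "norm (s *\<^sub>R h) = norm x + \<bar>B\<bar> + 1"
    using h by (auto simp: s_def)
  then have "norm (x + s *\<^sub>R h) \<le> B"
    using R B by blast
  moreover have "norm (s *\<^sub>R h) \<le> norm (x + s *\<^sub>R h) + norm x"
    by (metis add_diff_cancel_left' norm_triangle_ineq4)
  ultimately show False
    using s by linarith
qed

text \<open>The part of the superlevel set in \<open>T\<close> is convex, hence connected. A bounded
  component lies inside it, and by maximality also contains it, so any two bounded components
  coincide.\<close>

lemma at_most_one_bounded_component:
  fixes F :: "'a::euclidean_space \<Rightarrow> real"
  assumes conc: "convex_on T (\<lambda>x. - F x)"
    and sub: "\<And>K. K \<in> components (region_above F t) \<Longrightarrow> bounded K \<Longrightarrow> K \<subseteq> T"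
  shows "\<exists>\<^sub>\<le>\<^sub>1 K. K \<in> components (region_above F t) \<and> bounded K"
proof -
  let ?C = "{x \<in> T. - F x < - t}"
  have conn: "connected ?C"
  proof (rule convex_connected, rule convexI)
    fix x y :: 'a and u v :: real
    assume xy: "x \<in> ?C" "y \<in> ?C" and uv: "0 \<le> u" "0 \<le> v" "u + v = 1"
    have "u *\<^sub>R x + v *\<^sub>R y \<in> T"
      using xy uv convex_on_imp_convex[OF conc] by (auto intro: convexD)
    moreover have "- F (u *\<^sub>R x + v *\<^sub>R y) \<le> u * - F x + v * - F y"
      using conc xy uv unfolding convex_on_def by blast
    moreover have "u * - F x + v * - F y < - t"
      using xy uv by (intro convex_bound_lt) auto
    ultimately show "u *\<^sub>R x + v *\<^sub>R y \<in> ?C" by simp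
  qed
  have CK: "?C \<subseteq> K \<and> K \<subseteq> ?C \<and> ?C \<noteq> {}" if K: "K \<in> components (region_above F t)" "bounded K" for K
  proof -
    have KC: "K \<subseteq> ?C"
      using sub[OF K] in_components_subset[OF K(1)] by (auto simp: region_above_def)
    moreover have "K \<noteq> {}"
      using K(1) by (rule in_components_nonempty)
    ultimately show ?thesis
      using components_maximal[OF K(1) conn] by (auto simp: region_above_def)
  qed
  show ?thesis
    unfolding Uniq_def using CK by blast
qed

section \<open>Moving two pre-activations and fixing the others\<close>

text \<open>Dimension count: the range has dimension one less than the hidden space, so it fills any
  hyperplane containing it.\<close>

lemma range_matrix_vector_mult_eq_hyperplane:
  fixes W :: "real ^ 'n ^ 'm"
  assumes card: "CARD('m) = CARD('n) + 1" and inj: "inj ((*v) W)"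
  obtains l where "l \<noteq> 0" "range ((*v) W) = {u. l \<bullet> u = 0}"
proof -
  have dim: "dim (range ((*v) W)) = CARD('n)"
    using dim_image_eq[of "(*v) W" UNIV] inj by simp
  then have "dim (range ((*v) W)) < DIM(real ^ 'm)"
    using card by simp
  then obtain l where l: "l \<noteq> 0" "span (range ((*v) W)) \<subseteq> {u. l \<bullet> u = 0}"
    using lowdim_subset_hyperplane by blast
  have sub: "subspace (range ((*v) W))"
    by (intro linear_subspace_image) auto
  have "range ((*v) W) = {u. l \<bullet> u = 0}"
  proof (rule subspace_dim_equal)
    show "range ((*v) W) \<subseteq> {u. l \<bullet> u = 0}"
      using l(2) span_superset by blast
    show "dim {u. l \<bullet> u = 0} \<le> dim (range ((*v) W))"
      using dim_hyperplane[OF l(1)] dim card by simp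
  qed (use sub subspace_hyperplane in auto)
  with l that show thesis by blast
qed

text \<open>The change of pre-activations \<open>u\<close> is orthogonal to \<open>l\<close>, so an
  input direction \<open>h\<close> realises it. Along \<open>h\<close> only the terms
  \<open>i\<close> and \<open>j\<close> of the network vary, and boundedness forces their sum to
  drop somewhere.\<close>

lemma bounded_component_pair_decreases:
  fixes W :: "real ^ 'n ^ 'm" and x :: "real ^ 'n"
  assumes K: "K \<in> components (region_above (relu_network W b w c) t)" "bounded K" "x \<in> K"
    and range: "range ((*v) W) = {u. l \<bullet> u = 0}"
    and ij: "i \<noteq> j" and l: "l $ i \<noteq> 0 \<or> l $ j \<noteq> 0" and r: "r \<noteq> 0"
  shows "\<exists>s\<ge>0. w $ i * relu (W $ i \<bullet> x + b $ i + s * (r * l $ j))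
           + w $ j * relu (W $ j \<bullet> x + b $ j - s * (r * l $ i))
         < w $ i * relu (W $ i \<bullet> x + b $ i) + w $ j * relu (W $ j \<bullet> x + b $ j)"
proof -
  define u where "u = r *\<^sub>R (axis i (l $ j) - axis j (l $ i))"
  have u: "u $ i = r * l $ j" "u $ j = - r * l $ i" "\<And>k. k \<noteq> i \<Longrightarrow> k \<noteq> j \<Longrightarrow> u $ k = 0"
    using ij by (auto simp: u_def axis_def)
  have "l \<bullet> u = 0"
    by (simp add: u_def inner_diff_right inner_axis algebra_simps)
  then obtain h where h: "W *v h = u"
    using range by (metis (mono_tags, lifting) mem_Collect_eq rangeE)
  have Wh: "W $ k \<bullet> h = u $ k" for k
    using h by (metis matrix_vector_mul_component)
  have "u \<noteq> 0"
    using u(1,2) l r by (metis mult_eq_0_iff neg_equal_0_iff_equal zero_index)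
  then have "h \<noteq> 0"
    using h by auto
  then obtain s where s: "s \<ge> 0"
    and less: "relu_network W b w c (x + s *\<^sub>R h) < relu_network W b w c x"
    using unbounded_component_if_nondecreasing_ray[OF K(1,3)] K(2) by (meson not_le)
  have split: "(\<Sum>k\<in>UNIV. f k) = f i + f j + (\<Sum>k\<in>UNIV - {i, j}. f k)" for f :: "'m \<Rightarrow> real"
    using sum.subset_diff[of "{i, j}" UNIV f] ij by simp
  have "(\<Sum>k\<in>UNIV - {i, j}. w $ k * relu (W $ k \<bullet> (x + s *\<^sub>R h) + b $ k))
      = (\<Sum>k\<in>UNIV - {i, j}. w $ k * relu (W $ k \<bullet> x + b $ k))"
    by (intro sum.cong) (auto simp: inner_add_right Wh u)
  then show ?thesis
    using less s by (intro exI[of _ s]) (simp add: relu_network_eq_sum split inner_add_right Wh u algebra_simps)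
qed

section \<open>Sign pattern of the weights and uniqueness of the bounded component\<close>

lemma at_most_one_bounded_component_above:
  fixes W :: "real ^ 'n ^ 'm"
  assumes card: "CARD('m) = CARD('n) + 1"
  shows "\<exists>\<^sub>\<le>\<^sub>1 K. K \<in> components (region_above (relu_network W b w c) t) \<and> bounded K"
proof (cases "\<exists>K. K \<in> components (region_above (relu_network W b w c) t) \<and> bounded K")
  case False
  then show ?thesis unfolding Uniq_def by blast
next
  case True
  let ?F = "relu_network W b w c"
  let ?z = "\<lambda>x k. W $ k \<bullet> x + b $ k"
  obtain K where K: "K \<in> components (region_above ?F t)" "bounded K"
    using True by blast
  obtain x where x: "x \<in> K"
    using in_components_nonempty[OF K(1)] by blast
  \<comment> \<open>The network is constant along a kernel direction, which would make
    \<open>K\<close> unbounded.\<close>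
  have "inj ((*v) W)"
  proof (rule ccontr)
    assume "\<not> inj ((*v) W)"
    then obtain h where h: "W *v h = 0" "h \<noteq> 0"
      using matrix_left_invertible_ker matrix_left_invertible_injective by blast
    then have "?F (x + s *\<^sub>R h) = ?F x" for s
      by (simp add: relu_network_def matrix_vector_right_distrib matrix_vector_mult_scaleR)
    then show False
      using unbounded_component_if_nondecreasing_ray[OF K(1) x h(2)] K(2) by simp
  qed
  then obtain l0 where l0: "l0 \<noteq> 0" "range ((*v) W) = {u. l0 \<bullet> u = 0}"
    using range_matrix_vector_mult_eq_hyperplane[OF card] by blast
  \<comment> \<open>Otherwise \<open>w $ i * l0 $ j\<close> and \<open>- (w $ j * l0 $ i)\<close>
    have no opposite signs, and a choice of \<open>r\<close> as 1 or -1 gives a ray along which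
    neither of the two terms ever drops.\<close>
  have pos: "0 < (w $ i * l0 $ i) * (w $ j * l0 $ j)"
    if ij: "i \<noteq> j" "l0 $ i \<noteq> 0 \<or> l0 $ j \<noteq> 0" for i j
  proof (rule ccontr)
    assume "\<not> ?thesis"
    then have "0 \<le> (w $ i * l0 $ j) * - (w $ j * l0 $ i)"
      by (simp add: algebra_simps)
    then consider "0 \<le> w $ i * l0 $ j" "0 \<le> - (w $ j * l0 $ i)"
      | "w $ i * l0 $ j \<le> 0" "- (w $ j * l0 $ i) \<le> 0"
      unfolding zero_le_mult_iff[of "w $ i * l0 $ j"] by blast
    then obtain r :: real where r: "r \<noteq> 0" "0 \<le> w $ i * (r * l0 $ j)" "0 \<le> w $ j * (- r * l0 $ i)"
    proof cases
      case 1
      then show ?thesis using that[of 1] by simp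
    next
      case 2
      then show ?thesis using that[of "-1"] by simp
    qed
    have mono: "v * relu y \<le> v * relu (y + s * d)" if "0 \<le> v * d" "0 \<le> s" for v y s d :: real
    proof (cases "v = 0")
      case False
      then consider "v > 0" "d \<ge> 0" | "v < 0" "d \<le> 0"
        using \<open>0 \<le> v * d\<close> by (auto simp: zero_le_mult_iff)
      then show ?thesis
        using \<open>0 \<le> s\<close>
        by cases (auto intro!: relu_mono mult_left_mono mult_left_mono_neg simp: mult_nonneg_nonpos)
    qed simp
    obtain s where s: "s \<ge> 0"
      "w $ i * relu (?z x i + s * (r * l0 $ j)) + w $ j * relu (?z x j - s * (r * l0 $ i))
         < w $ i * relu (?z x i) + w $ j * relu (?z x j)"
      using bounded_component_pair_decreases[OF K x l0(2) ij r(1)] by blast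
    then show False
      using mono[OF r(2) s(1), of "?z x i"] mono[OF r(3) s(1), of "?z x j"] by (simp add: algebra_simps)
  qed
  obtain k where k: "l0 $ k \<noteq> 0"
    using l0(1) by (auto simp: vec_eq_iff)
  \<comment> \<open>As \<open>CARD('n)\<close> is at least 1, there are at least two hidden neurons,
    so every index has a partner.\<close>
  have other: "\<exists>j. j \<noteq> i" for i :: 'm
  proof (rule ccontr)
    assume "\<nexists>j. j \<noteq> i"
    then have "(UNIV :: 'm set) = {i}" by auto
    then have "CARD('m) = 1" by (metis card_1_singleton_iff One_nat_def)
    then show False using card by simp
  qed
  have "w $ k * l0 $ k \<noteq> 0"
    using other[of k] pos[of k] k by fastforce
  \<comment> \<open>Normalises the common sign of the products \<open>w $ j * l0 $ j\<close> to plus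
    without changing the hyperplane; then \<open>l $ j\<close> and \<open>w $ j\<close> have the
    same sign.\<close>
  define l where "l = sgn (w $ k * l0 $ k) *\<^sub>R l0"
  have range: "range ((*v) W) = {u. l \<bullet> u = 0}"
    using l0(2) \<open>w $ k * l0 $ k \<noteq> 0\<close> by (simp add: l_def sgn_zero_iff)
  have wl: "0 < w $ j * l $ j" for j
  proof -
    have "w $ j * l $ j = sgn (w $ k * l0 $ k) * (w $ j * l0 $ j)"
      by (simp add: l_def)
    moreover have "0 < (w $ k * l0 $ k) * (w $ j * l0 $ j)"
      using pos[of k j] k not_real_square_gt_zero \<open>w $ k * l0 $ k \<noteq> 0\<close> by (cases "j = k") blast+
    moreover have "0 < sgn p * q" if "0 < p * q" for p q :: real
      using that by (auto simp: sgn_if zero_less_mult_iff)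
    ultimately show ?thesis by (simp only:)
  qed
  have unique_pos: "i = j" if w: "w $ i > 0" "w $ j > 0" for i j
  proof (rule ccontr)
    assume ij: "i \<noteq> j"
    have li: "l $ i > 0" and lj: "l $ j > 0"
      using w wl[of i] wl[of j] by (auto simp: zero_less_mult_iff)
    let ?p = "w $ i" and ?q = "w $ j" and ?y = "?z x i" and ?v = "?z x j"
    have dec: "\<exists>s\<ge>0. ?p * relu (?y + s * (r * l $ j)) + ?q * relu (?v - s * (r * l $ i))
        < ?p * relu ?y + ?q * relu ?v" if "r \<noteq> 0" for r
      using bounded_component_pair_decreases[OF K x range ij _ that] li by simp
    obtain s where s: "s \<ge> 0"
      "?p * relu (?y + s * l $ j) + ?q * relu (?v - s * l $ i) < ?p * relu ?y + ?q * relu ?v"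
      using dec[of 1] by auto
    obtain s' where s': "s' \<ge> 0"
      "?p * relu (?y - s' * l $ j) + ?q * relu (?v + s' * l $ i) < ?p * relu ?y + ?q * relu ?v"
      using dec[of "-1"] by auto
    have a: "?p * relu ?y \<le> ?p * relu (?y + s * l $ j)" "0 \<le> ?q * relu (?v - s * l $ i)"
      using s(1) li lj w by (auto intro!: mult_left_mono relu_mono simp: relu_nonneg)
    have a': "0 \<le> ?p * relu (?y - s' * l $ j)" "?q * relu ?v \<le> ?q * relu (?v + s' * l $ i)"
      using s'(1) li lj w by (auto intro!: mult_left_mono relu_mono simp: relu_nonneg)
    \<comment> \<open>If \<open>?v\<close> were not positive, its term would already be at its
      minimum 0, while the ray for \<open>r = 1\<close> raises the other one. The ray for
      \<open>r = -1\<close> treats \<open>?y\<close> likewise.\<close>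
    have "?v > 0"
    proof (rule ccontr)
      assume "\<not> ?v > 0"
      then have "?q * relu ?v = 0" by (simp add: relu_def)
      then show False using a s(2) by linarith
    qed
    moreover have "?y > 0"
    proof (rule ccontr)
      assume "\<not> ?y > 0"
      then have "?p * relu ?y = 0" by (simp add: relu_def)
      then show False using a' s'(2) by linarith
    qed
    ultimately have yv: "relu ?y = ?y" "relu ?v = ?v"
      by (auto simp: relu_def)
    \<comment> \<open>Bounding ReLU below by the identity replaces both drops by linear ones, whose
      slopes are negatives of each other and cannot both be negative.\<close>
    have ge: "?p * e \<le> ?p * relu e" "?q * e \<le> ?q * relu e" for e
      using w by (auto simp: relu_def)
    have "?p * (?y + s * l $ j) + ?q * (?v - s * l $ i) < ?p * ?y + ?q * ?v"
      using s(2)[unfolded yv] ge(1)[of "?y + s * l $ j"] ge(2)[of "?v - s * l $ i"] by linarith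
    then have "s * (?p * l $ j - ?q * l $ i) < 0"
      by (simp add: algebra_simps)
    moreover have "?p * (?y - s' * l $ j) + ?q * (?v + s' * l $ i) < ?p * ?y + ?q * ?v"
      using s'(2)[unfolded yv] ge(1)[of "?y - s' * l $ j"] ge(2)[of "?v + s' * l $ i"] by linarith
    then have "s' * (?q * l $ i - ?p * l $ j) < 0"
      by (simp add: algebra_simps)
    ultimately show False
      using s(1) s'(1) by (auto simp: mult_less_0_iff)
  qed
  \<comment> \<open>With neuron \<open>i\<close> inactive, the ray for \<open>r = 1\<close> lowers
    both pre-activations: the term \<open>i\<close> stays 0, and the term \<open>j\<close>, of
    negative weight, cannot drop.\<close>
  have active: "0 < ?z y i"
    if K': "K' \<in> components (region_above ?F t)" "bounded K'" "y \<in> K'" and wi: "w $ i > 0" for K' y i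
  proof (rule ccontr)
    assume neg: "\<not> 0 < ?z y i"
    obtain j where j: "j \<noteq> i" using other by blast
    have wj: "w $ j < 0"
      using wl[of j] unique_pos[OF wi, of j] j by (auto simp: zero_less_mult_iff)
    have li: "l $ i > 0" and lj: "l $ j < 0"
      using wl[of i] wl[of j] wi wj by (auto simp: zero_less_mult_iff)
    obtain s where s: "s \<ge> 0"
      "w $ i * relu (?z y i + s * (1 * l $ j)) + w $ j * relu (?z y j - s * (1 * l $ i))
        < w $ i * relu (?z y i) + w $ j * relu (?z y j)"
      using bounded_component_pair_decreases[OF K' range, of i j 1] j li by auto
    have "s * l $ j \<le> 0" "0 \<le> s * l $ i"
      using s(1) li lj by (auto simp: mult_nonneg_nonpos)
    then have "relu (?z y i) = 0" "relu (?z y i + s * (1 * l $ j)) = 0"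
      "w $ j * relu (?z y j) \<le> w $ j * relu (?z y j - s * (1 * l $ i))"
      using neg wj by (auto simp: relu_def intro: mult_left_mono_neg)
    then show False using s(2) by simp
  qed
  define T where "T = {y. \<forall>i. w $ i > 0 \<longrightarrow> 0 < ?z y i}"
  have "0 < p + q \<longleftrightarrow> - q < p" for p q :: real
    by linarith
  then have "T = (\<Inter>i\<in>{i. w $ i > 0}. {y. W $ i \<bullet> y > - b $ i})"
    by (simp add: T_def set_eq_iff)
  then have "convex T"
    by (auto intro!: convex_INT convex_halfspace_gt)
  \<comment> \<open>On \<open>T\<close> a term of positive weight is affine, since its ReLU acts as
    the identity; any other term is a nonpositive multiple of a convex function.\<close>
  have "convex_on T (\<lambda>y. - (w $ k * relu (?z y k)))" for k
  proof (cases "w $ k > 0")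
    case True
    then have eq: "relu (?z y k) = ?z y k" if "y \<in> T" for y
      using that by (force simp: T_def relu_def)
    show ?thesis
    proof (rule convex_onI[OF _ \<open>convex T\<close>])
      fix s :: real and y y' :: "real ^ 'n"
      assume s: "0 < s" "s < 1" and y: "y \<in> T" "y' \<in> T"
      have "(1 - s) *\<^sub>R y + s *\<^sub>R y' \<in> T"
        using convexD_alt[OF \<open>convex T\<close> y] s by simp
      then show "- (w $ k * relu (?z ((1 - s) *\<^sub>R y + s *\<^sub>R y') k))
          \<le> (1 - s) * - (w $ k * relu (?z y k)) + s * - (w $ k * relu (?z y' k))"
        by (simp only: eq y) (simp add: inner_add_right algebra_simps)
    qed
  next
    case False
    then show ?thesis
      using convex_on_cmul[OF _ convex_on_relu_affine[OF \<open>convex T\<close>], of "- w $ k"] by simp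
  qed
  then have "convex_on T (\<lambda>y. (\<Sum>k\<in>UNIV. - (w $ k * relu (?z y k))) + - c)"
    using \<open>convex T\<close> by (intro convex_on_add convex_on_sum_UNIV) (auto simp: convex_on_const)
  then have "convex_on T (\<lambda>y. - ?F y)"
    by (simp add: relu_network_eq_sum sum_negf)
  then show ?thesis
    by (rule at_most_one_bounded_component) (use active in \<open>auto simp: T_def\<close>)
qed

theorem theorem6:
  fixes W :: "real ^ 'n ^ 'm" and b w :: "real ^ 'm" and c t :: real
  assumes "CARD('m) = CARD('n) + 1"
    and "transversal_threshold (relu_network W b w c) (canonical_complex W b) t"
  shows "(\<exists>\<^sub>\<le>\<^sub>1 K. K \<in> components (region_above (relu_network W b w c) t) \<and> bounded K)
    \<and> (\<exists>\<^sub>\<le>\<^sub>1 K. K \<in> components (region_below (relu_network W b w c) t) \<and> bounded K)"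
proof -
  \<comment> \<open>Negating the output layer and the threshold exchanges the two decision
    regions.\<close>
  have "region_below (relu_network W b w c) t = region_above (relu_network W b (- w) (- c)) (- t)"
    by (auto simp: region_below_def region_above_def relu_network_uminus)
  then show ?thesis
    using at_most_one_bounded_component_above[OF assms(1)] by metis
qed

end
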